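(* For every $\tau\in\mathbb{H}^2$, $$\theta'[1,\tfrac12](0,\tau)=\frac14\,\frac{\theta'[1,1](0,\tau)\,\theta^3[1,0](0,\tau)}{\theta^3[1,\tfrac12](0,\tau)}=-\pi\,\theta^2[0,0](0,2\tau)\,\theta[1,\tfrac12](0,\tau)$$ and $$\theta'[0,\tfrac12](0,\tau)=\frac14\,\frac{\theta'[1,1](0,\tau)\,\theta^3[1,0](0,\tau)}{\theta^3[0,\tfrac12](0,\tau)}=-\pi\,\theta^2[1,0](0,2\tau)\,\theta[0,\tfrac12](0,\tau).$$
   Context: $\mathbb{H}^2=\{\tau\in\mathbb{C} : \Im\tau>0\}$ is the upper half plane. For $\epsilon,\epsilon'\in\mathbb{R}$, $\zeta\in\mathbb{C}$, $\tau\in\mathbb{H}^2$, the theta function with characteristics is $$\theta[\epsilon,\epsilon'](\zeta,\tau)=\sum_{n\in\mathbb{Z}}\exp\left(2\pi i\left[\tfrac12\left(n+\tfrac{\epsilon}{2}\right)^2\tau+\left(n+\tfrac{\epsilon}{2}\right)\left(\zeta+\tfrac{\epsilon'}{2}\right)\right]\right),$$ and $\theta'[\epsilon,\epsilon'](0,\tau)=\frac{\partial}{\partial\zeta}\theta[\epsilon,\epsilon'](\zeta,\tau)\big|_{\zeta=0}$. The notation $\theta^k[\epsilon,\epsilon'](0,\tau)$ means the $k$-th power of the number $\theta[\epsilon,\epsilon'](0,\tau)$. *)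

theory Defs
  imports "HOL-Complex_Analysis.Complex_Analysis"
begin

definition theta_char :: "real \<Rightarrow> real \<Rightarrow> complex \<Rightarrow> complex \<Rightarrow> complex" where
  "theta_char \<epsilon> \<epsilon>' \<zeta> \<tau> =
     (\<Sum>\<^sub>\<infinity>n::int. exp (2 * of_real pi * \<i> *
        (1 / 2 * (of_int n + of_real \<epsilon> / 2)\<^sup>2 * \<tau>
         + (of_int n + of_real \<epsilon> / 2) * (\<zeta> + of_real \<epsilon>' / 2))))"

definition theta_char_deriv0 :: "real \<Rightarrow> real \<Rightarrow> complex \<Rightarrow> complex" where
  "theta_char_deriv0 \<epsilon> \<epsilon>' \<tau> = deriv (\<lambda>\<zeta>. theta_char \<epsilon> \<epsilon>' \<zeta> \<tau>) 0"

end

theory Submission imports Defs "HOL-Real_Asymp.Real_Asymp" begin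

text \<open>
  Write \<open>A\<close>, \<open>B\<close>, \<open>C\<close> for the theta constants with characteristics \<open>[1,0]\<close>, \<open>[0,0]\<close>, \<open>[0,1]\<close> at \<open>2\<tau>\<close>.
  Everything follows from one product formula (\<open>theta_char_product\<close>): multiplying two theta series at
  \<open>\<tau>\<close> and rotating the summation lattice by \<open>(m,n) \<mapsto> ((m+n)/2, (m-n)/2)\<close> turns the product into a sum of two
  products of theta series at \<open>2\<tau>\<close>.  Applied with equal arguments it expresses
  \<open>\<theta>[1,1/2](\<zeta>,\<tau>)\<^sup>2\<close> and \<open>\<theta>[0,1/2](\<zeta>,\<tau>)\<^sup>2\<close> linearly in \<open>\<theta>[1,1](2\<zeta>,2\<tau>)\<close> and \<open>\<theta>[0,1](2\<zeta>,2\<tau>)\<close>.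
  Because \<open>\<theta>[1,1]\<close> is odd and \<open>\<theta>[0,1]\<close> even in \<open>\<zeta>\<close>, the values at \<open>\<zeta> = 0\<close> give \<open>\<theta>[1,1/2]\<^sup>2 = A C\<close> and
  \<open>\<theta>[0,1/2]\<^sup>2 = B C\<close>, and the derivatives at \<open>\<zeta> = 0\<close> are multiples of \<open>\<theta>'[1,1](0,2\<tau>)\<close>.

  The remaining input is Jacobi's derivative formula \<open>\<theta>'[1,1] = -\<pi> \<theta>[0,0] \<theta>[0,1] \<theta>[1,0]\<close>
  (\<open>jacobi_derivative_formula\<close>).  By the product formula, the quotient of its two sides takes the same value at
  \<open>\<tau>\<close> and at \<open>2\<tau>\<close>, hence at all \<open>2\<^sup>k\<tau>\<close>; as the imaginary part tends to infinity only the terms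
  of smallest \<open>|n + \<epsilon>/2|\<close> survive in each series (\<open>theta_char_degeneration\<close>), which evaluates the quotient.
  The same doubling argument shows that the theta constants \<open>[0,0]\<close>, \<open>[0,1]\<close>, \<open>[1,0]\<close> never vanish: a zero of
  \<open>[0,1]\<close> or \<open>[1,0]\<close> at \<open>\<tau>\<close> would propagate to all \<open>2\<^sup>k\<tau>\<close> and contradict the nonzero limit, and a zero of \<open>[0,0]\<close> at
  \<open>\<tau>\<close> would give one of \<open>[0,1]\<close> at \<open>2\<tau>\<close>.  Hence \<open>A C\<close> and \<open>B C\<close> are nonzero, so the
  divisions in the identities are legitimate.
\<close>

section \<open>The theta series as holomorphic functions\<close>

definition theta_term :: "real \<Rightarrow> real \<Rightarrow> complex \<Rightarrow> complex \<Rightarrow> int \<Rightarrow> complex" where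
  "theta_term \<epsilon> \<epsilon>' \<zeta> \<tau> n =
     exp (2 * of_real pi * \<i> *
        (1 / 2 * (of_int n + of_real \<epsilon> / 2)\<^sup>2 * \<tau>
         + (of_int n + of_real \<epsilon> / 2) * (\<zeta> + of_real \<epsilon>' / 2)))"

lemma theta_char_eq_infsum: "theta_char \<epsilon> \<epsilon>' \<zeta> \<tau> = infsum (theta_term \<epsilon> \<epsilon>' \<zeta> \<tau>) UNIV"
  by (simp add: theta_char_def theta_term_def [abs_def])

lemma norm_theta_term:
  "norm (theta_term \<epsilon> \<epsilon>' \<zeta> \<tau> n)
     = exp (- pi * (of_int n + \<epsilon> / 2)\<^sup>2 * Im \<tau> - 2 * pi * (of_int n + \<epsilon> / 2) * Im \<zeta>)"
proof -
  define m :: real where "m = of_int n + \<epsilon> / 2"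
  have "theta_term \<epsilon> \<epsilon>' \<zeta> \<tau> n
      = exp (2 * of_real pi * \<i> * (1 / 2 * (of_real m)\<^sup>2 * \<tau> + of_real m * (\<zeta> + of_real \<epsilon>' / 2)))"
    by (simp add: theta_term_def m_def)
  also have "norm \<dots> = exp (- pi * m\<^sup>2 * Im \<tau> - 2 * pi * m * Im \<zeta>)"
    by (simp add: norm_exp_eq_Re power2_eq_square algebra_simps)
  finally show ?thesis by (simp add: m_def)
qed

text \<open>
  A summable bound for the series that is uniform over the strip \<open>|Im \<zeta>| \<le> R\<close> and the half plane \<open>Im \<tau> \<ge> t\<close>; it
  serves both for holomorphy in \<open>\<zeta>\<close> and for the limit \<open>Im \<tau> \<rightarrow> \<infinity>\<close>.
\<close>
definition theta_majorant :: "real \<Rightarrow> real \<Rightarrow> real \<Rightarrow> int \<Rightarrow> real" where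
  "theta_majorant \<epsilon> t R n = exp (- pi * (of_int n + \<epsilon> / 2)\<^sup>2 * t + 2 * pi * \<bar>of_int n + \<epsilon> / 2\<bar> * R)"

lemma norm_theta_term_le_majorant:
  assumes "t \<le> Im \<tau>" "\<bar>Im \<zeta>\<bar> \<le> R"
  shows "norm (theta_term \<epsilon> \<epsilon>' \<zeta> \<tau> n) \<le> theta_majorant \<epsilon> t R n"
proof -
  define m :: real where "m = of_int n + \<epsilon> / 2"
  have "pi * m\<^sup>2 * t \<le> pi * m\<^sup>2 * Im \<tau>"
    using assms by (intro mult_left_mono) auto
  moreover have "- (m * Im \<zeta>) \<le> \<bar>m\<bar> * R"
    using mult_left_mono[OF assms(2), of "\<bar>m\<bar>"] abs_le_D2[of "m * Im \<zeta>" "\<bar>m\<bar> * R"]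
    by (simp add: abs_mult)
  hence "pi * - (m * Im \<zeta>) \<le> pi * (\<bar>m\<bar> * R)"
    by (intro mult_left_mono) auto
  moreover have "- pi * m\<^sup>2 * Im \<tau> - 2 * pi * m * Im \<zeta> = - (pi * m\<^sup>2 * Im \<tau>) + 2 * (pi * - (m * Im \<zeta>))"
    and "- pi * m\<^sup>2 * t + 2 * pi * \<bar>m\<bar> * R = - (pi * m\<^sup>2 * t) + 2 * (pi * (\<bar>m\<bar> * R))"
    by simp_all
  ultimately have "- pi * m\<^sup>2 * Im \<tau> - 2 * pi * m * Im \<zeta> \<le> - pi * m\<^sup>2 * t + 2 * pi * \<bar>m\<bar> * R"
    by linarith
  thus ?thesis
    by (simp only: norm_theta_term theta_majorant_def m_def [symmetric] exp_le_cancel_iff)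
qed

lemma summable_on_exp_neg_abs_int: "(\<lambda>n::int. exp (- \<bar>of_int n\<bar> :: real)) summable_on UNIV"
proof -
  have geo: "(\<lambda>k::nat. exp (- real k)) summable_on UNIV"
  proof (rule norm_summable_imp_summable_on)
    have "(\<lambda>k. norm (exp (- real k))) = (\<lambda>k. exp (- 1 :: real) ^ k)"
      by (simp add: exp_of_nat_mult [symmetric])
    thus "summable (\<lambda>k. norm (exp (- real k)))"
      by (simp add: summable_geometric_iff)
  qed
  have nonneg: "(\<lambda>n::int. exp (- \<bar>of_int n\<bar> :: real)) summable_on range int"
    by (subst summable_on_reindex) (use geo in \<open>auto simp: o_def\<close>)
  have neg: "(\<lambda>n::int. exp (- \<bar>of_int n\<bar> :: real)) summable_on range (\<lambda>k. - int k)"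
    by (subst summable_on_reindex) (use geo in \<open>auto simp: o_def inj_on_def\<close>)
  have neg': "(\<lambda>n::int. exp (- \<bar>of_int n\<bar> :: real)) summable_on (range (\<lambda>k. - int k) - range int)"
    by (rule summable_on_subset_banach[OF neg]) auto
  have "range int \<union> (range (\<lambda>k. - int k) - range int) = UNIV"
    by (auto simp: image_iff) (metis int_cases2)
  with summable_on_Un_disjoint[OF nonneg neg'] show ?thesis by auto
qed

text \<open>
  The exponent is a negative quadratic in \<open>|n + \<epsilon>/2|\<close> plus a linear term; completing the square bounds it by a
  constant minus \<open>|n|\<close>, so a geometric series dominates.
\<close>
lemma summable_theta_majorant:
  assumes "t > 0"
  shows "theta_majorant \<epsilon> t R summable_on UNIV"
proof -
  define K where "K = (2 * pi * R + 1)\<^sup>2 / (4 * pi * t) + \<bar>\<epsilon> / 2\<bar>"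
  have bound: "theta_majorant \<epsilon> t R n \<le> exp K * exp (- \<bar>of_int n\<bar>)" for n
  proof -
    define m :: real where "m = of_int n + \<epsilon> / 2"
    define b where "b = 2 * pi * R + 1"
    have pos: "4 * pi * t > 0" using assms by simp
    \<comment> \<open>This is \<open>(2\<pi>tM - b)\<^sup>2 \<ge> 0\<close> rearranged.\<close>
    have "4 * pi * t * (b * M - pi * t * M\<^sup>2) \<le> b\<^sup>2" for M
      using zero_le_power2[of "2 * pi * t * M - b"] by (simp add: power2_eq_square algebra_simps)
    from this[of "\<bar>m\<bar>"] have "b * \<bar>m\<bar> - pi * t * m\<^sup>2 \<le> b\<^sup>2 / (4 * pi * t)"
      using pos by (simp add: pos_le_divide_eq mult.commute)
    moreover have "\<bar>of_int n\<bar> \<le> \<bar>m\<bar> + \<bar>\<epsilon> / 2\<bar>"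
      unfolding m_def by linarith
    ultimately have "- pi * m\<^sup>2 * t + 2 * pi * \<bar>m\<bar> * R \<le> K - \<bar>of_int n\<bar>"
      unfolding K_def b_def by (simp add: algebra_simps)
    thus ?thesis
      by (simp add: theta_majorant_def m_def exp_add [symmetric])
  qed
  have "(\<lambda>n::int. exp K * exp (- \<bar>of_int n\<bar>)) summable_on UNIV"
    by (intro summable_on_cmult_right summable_on_exp_neg_abs_int)
  hence "(\<lambda>n. norm (theta_majorant \<epsilon> t R n)) summable_on UNIV"
    by (rule Infinite_Sum.abs_summable_on_comparison_test') (use bound in \<open>auto simp: theta_majorant_def\<close>)
  thus ?thesis by (simp add: theta_majorant_def [abs_def])
qed

lemma theta_term_abs_summable:
  assumes "Im \<tau> > 0"
  shows "(\<lambda>n. norm (theta_term \<epsilon> \<epsilon>' \<zeta> \<tau> n)) summable_on UNIV"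
  by (rule Infinite_Sum.abs_summable_on_comparison_test'[OF summable_theta_majorant[OF assms]])
     (rule norm_theta_term_le_majorant, auto)

lemma theta_char_holomorphic:
  assumes "Im \<tau> > 0"
  shows "(\<lambda>\<zeta>. theta_char \<epsilon> \<epsilon>' \<zeta> \<tau>) holomorphic_on A"
proof -
  have "(\<lambda>\<zeta>. theta_char \<epsilon> \<epsilon>' \<zeta> \<tau>) holomorphic_on ball 0 R" for R
  proof (rule holomorphic_uniform_limit)
    show "uniform_limit (cball 0 R) (\<lambda>X \<zeta>. \<Sum>n\<in>X. theta_term \<epsilon> \<epsilon>' \<zeta> \<tau> n)
            (\<lambda>\<zeta>. theta_char \<epsilon> \<epsilon>' \<zeta> \<tau>) (finite_subsets_at_top UNIV)"
      unfolding theta_char_eq_infsum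
    proof (rule Weierstrass_m_test_general)
      fix n \<zeta> assume "\<zeta> \<in> cball (0::complex) R"
      hence "\<bar>Im \<zeta>\<bar> \<le> R" using abs_Im_le_cmod[of \<zeta>] by simp
      thus "norm (theta_term \<epsilon> \<epsilon>' \<zeta> \<tau> n) \<le> theta_majorant \<epsilon> (Im \<tau>) R n"
        by (intro norm_theta_term_le_majorant) auto
    qed (rule summable_theta_majorant[OF assms])
    have "(\<lambda>\<zeta>. \<Sum>n\<in>X. theta_term \<epsilon> \<epsilon>' \<zeta> \<tau> n) holomorphic_on B" for X B
      unfolding theta_term_def by (intro holomorphic_intros)
    thus "\<forall>\<^sub>F X in finite_subsets_at_top UNIV.
            continuous_on (cball 0 R) (\<lambda>\<zeta>. \<Sum>n\<in>X. theta_term \<epsilon> \<epsilon>' \<zeta> \<tau> n) \<and>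
            (\<lambda>\<zeta>. \<Sum>n\<in>X. theta_term \<epsilon> \<epsilon>' \<zeta> \<tau> n) holomorphic_on ball 0 R"
      by (intro always_eventually) (auto intro: holomorphic_on_imp_continuous_on)
  qed auto
  hence "(\<lambda>\<zeta>. theta_char \<epsilon> \<epsilon>' \<zeta> \<tau>) field_differentiable (at z)" for z
    by (rule holomorphic_on_imp_differentiable_at[of _ "ball 0 (norm z + 1)"]) auto
  thus ?thesis
    by (simp add: holomorphic_on_def field_differentiable_at_within)
qed

lemma theta_char_has_deriv0:
  assumes "Im \<tau> > 0"
  shows "((\<lambda>\<zeta>. theta_char \<epsilon> \<epsilon>' \<zeta> \<tau>) has_field_derivative theta_char_deriv0 \<epsilon> \<epsilon>' \<tau>) (at 0)"
  unfolding theta_char_deriv0_def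
  by (rule holomorphic_derivI[OF theta_char_holomorphic[OF assms, of _ _ UNIV]]) auto

section \<open>Symmetries and the product formula\<close>

lemma theta_char_shift_upper: "theta_char (\<epsilon> + 2) \<epsilon>' \<zeta> \<tau> = theta_char \<epsilon> \<epsilon>' \<zeta> \<tau>"
  unfolding theta_char_eq_infsum
  by (rule infsum_reindex_bij_witness[of _ "\<lambda>n. n - 1" "\<lambda>n. n + 1"])
     (auto simp: theta_term_def add_divide_distrib add_ac)

lemma theta_char_shift_lower:
  "theta_char \<epsilon> (\<epsilon>' + 2) \<zeta> \<tau> = exp (of_real pi * \<i> * of_real \<epsilon>) * theta_char \<epsilon> \<epsilon>' \<zeta> \<tau>"
proof -
  have "theta_term \<epsilon> (\<epsilon>' + 2) \<zeta> \<tau> = (\<lambda>n. exp (of_real pi * \<i> * of_real \<epsilon>) * theta_term \<epsilon> \<epsilon>' \<zeta> \<tau> n)"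
  proof
    fix n
    have "theta_term \<epsilon> (\<epsilon>' + 2) \<zeta> \<tau> n = theta_term \<epsilon> \<epsilon>' \<zeta> \<tau> n
            * exp (of_real pi * \<i> * of_real \<epsilon>) * exp (of_int (2 * n) * (of_real pi * \<i>))"
      unfolding theta_term_def exp_add [symmetric]
      by (rule arg_cong[where f = exp]) (simp add: field_simps)
    moreover have "exp (of_int (2 * n) * (of_real pi * \<i>)) = 1"
      by (subst exp_eq_1) (auto intro!: exI[of _ n])
    ultimately show "theta_term \<epsilon> (\<epsilon>' + 2) \<zeta> \<tau> n = exp (of_real pi * \<i> * of_real \<epsilon>) * theta_term \<epsilon> \<epsilon>' \<zeta> \<tau> n"
      by simp
  qed
  thus ?thesis
    by (simp add: theta_char_eq_infsum infsum_cmult_right')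
qed

lemma theta_char_reflect: "theta_char (- \<epsilon>) (- \<epsilon>') (- \<zeta>) \<tau> = theta_char \<epsilon> \<epsilon>' \<zeta> \<tau>"
  unfolding theta_char_eq_infsum
  by (rule infsum_reindex_bij_witness[of _ uminus uminus])
     (auto simp: theta_term_def power2_eq_square algebra_simps)

text \<open>
  Put \<open>m = j + k + s\<close> and \<open>n = j - k\<close> with \<open>s \<in> {0,1}\<close>, the parity of \<open>m - n\<close>.  With \<open>u, v\<close> the half sum
  and half difference of the shifted indices \<open>m + \<epsilon>/2\<close> and \<open>n + \<delta>/2\<close>, the sum of their squares is
  \<open>2(u\<^sup>2 + v\<^sup>2)\<close>, so the double series separates into theta series at \<open>2\<tau>\<close>; the parity \<open>s\<close> raises both
  upper characteristics by one.
\<close>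
lemma theta_char_product:
  assumes "Im \<tau> > 0"
  shows "theta_char \<epsilon> \<epsilon>' x \<tau> * theta_char \<delta> \<delta>' y \<tau>
       = theta_char ((\<epsilon> + \<delta>) / 2) (\<epsilon>' + \<delta>') (x + y) (2 * \<tau>)
           * theta_char ((\<epsilon> - \<delta>) / 2) (\<epsilon>' - \<delta>') (x - y) (2 * \<tau>)
       + theta_char ((\<epsilon> + \<delta>) / 2 + 1) (\<epsilon>' + \<delta>') (x + y) (2 * \<tau>)
           * theta_char ((\<epsilon> - \<delta>) / 2 + 1) (\<epsilon>' - \<delta>') (x - y) (2 * \<tau>)"
proof -
  have double: "((\<lambda>(m, n). theta_term a a' u \<sigma> m * theta_term b b' v \<sigma> n)
          has_sum theta_char a a' u \<sigma> * theta_char b b' v \<sigma>) UNIV"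
    if "Im \<sigma> > 0" for a a' b b' u v \<sigma>
  proof -
    note sa = theta_term_abs_summable[OF that, of a a' u]
    note sb = theta_term_abs_summable[OF that, of b b' v]
    have "(\<lambda>p. norm (case p of (m, n) \<Rightarrow> theta_term a a' u \<sigma> m * theta_term b b' v \<sigma> n))
            summable_on UNIV \<times> UNIV"
      by (subst Infinite_Sum.abs_summable_on_Sigma_iff)
         (auto simp: norm_mult infsum_cmult_right' abs_mult
               intro!: summable_on_cmult_right summable_on_cmult_left sa sb)
    hence "(\<lambda>(m, n). theta_term a a' u \<sigma> m * theta_term b b' v \<sigma> n) summable_on UNIV \<times> UNIV"
      by (rule abs_summable_summable)
    moreover from this have
      "infsum (\<lambda>(m, n). theta_term a a' u \<sigma> m * theta_term b b' v \<sigma> n) (UNIV \<times> UNIV)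
         = theta_char a a' u \<sigma> * theta_char b b' v \<sigma>"
      by (subst infsum_Sigma_banach [symmetric])
         (auto simp: infsum_cmult_right' infsum_cmult_left' theta_char_eq_infsum)
    ultimately show ?thesis by (simp add: has_sum_iff)
  qed
  define f where "f = (\<lambda>(m, n). theta_term \<epsilon> \<epsilon>' x \<tau> m * theta_term \<delta> \<delta>' y \<tau> n)"
  \<comment> \<open>\<open>g 0\<close> and \<open>g 1\<close> parametrise the index pairs of equal and of opposite parity.\<close>
  define g where "g = (\<lambda>s (j, k). (j + k + s, j - k :: int))"
  have expo: "theta_term \<epsilon> \<epsilon>' x \<tau> (j + k + s) * theta_term \<delta> \<delta>' y \<tau> (j - k)
     = theta_term ((\<epsilon> + \<delta>) / 2 + of_int s) (\<epsilon>' + \<delta>') (x + y) (2 * \<tau>) j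
     * theta_term ((\<epsilon> - \<delta>) / 2 + of_int s) (\<epsilon>' - \<delta>') (x - y) (2 * \<tau>) k" for j k s
    unfolding theta_term_def exp_add [symmetric]
    by (rule arg_cong[where f = exp]) (simp add: power2_eq_square field_simps)
  have part: "(f has_sum (theta_char ((\<epsilon> + \<delta>) / 2 + of_int s) (\<epsilon>' + \<delta>') (x + y) (2 * \<tau>)
           * theta_char ((\<epsilon> - \<delta>) / 2 + of_int s) (\<epsilon>' - \<delta>') (x - y) (2 * \<tau>))) (range (g s))" for s
  proof -
    have "inj (g s)" by (auto simp: g_def inj_on_def)
    moreover have "f \<circ> g s = (\<lambda>(j, k). theta_term ((\<epsilon> + \<delta>) / 2 + of_int s) (\<epsilon>' + \<delta>') (x + y) (2 * \<tau>) j
        * theta_term ((\<epsilon> - \<delta>) / 2 + of_int s) (\<epsilon>' - \<delta>') (x - y) (2 * \<tau>) k)"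
      by (auto simp: f_def g_def expo fun_eq_iff)
    ultimately show ?thesis
      using assms by (simp add: has_sum_reindex double)
  qed
  have "p \<in> range (g 0) \<union> range (g 1)" for p
  proof -
    obtain m n where p: "p = (m, n)" by (cases p)
    show ?thesis
    proof (cases "even (m - n)")
      case True
      then obtain k where "m - n = 2 * k" by (elim evenE)
      hence "p = g 0 (n + k, k)" by (simp add: p g_def)
      thus ?thesis by blast
    next
      case False
      then obtain k where "m - n = 2 * k + 1" by (elim oddE)
      hence "p = g 1 (n + k, k)" by (simp add: p g_def)
      thus ?thesis by blast
    qed
  qed
  hence cover: "range (g 0) \<union> range (g 1) = UNIV" by blast
  have "g 0 p \<noteq> g 1 q" for p q
    by (cases p; cases q) (simp add: g_def, presburger)
  hence disj: "range (g 0) \<inter> range (g 1) = {}" by blast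
  have "(f has_sum (theta_char \<epsilon> \<epsilon>' x \<tau> * theta_char \<delta> \<delta>' y \<tau>)) UNIV"
    unfolding f_def by (rule double[OF assms])
  with has_sum_Un_disjoint[OF part part disj] show ?thesis
    unfolding cover by (auto dest: has_sum_unique)
qed

section \<open>Degeneration as the imaginary part tends to infinity\<close>

text \<open>
  After division by \<open>exp(\<pi>i(\<epsilon>/2)\<^sup>2\<tau>)\<close>, the terms with \<open>(n + \<epsilon>/2)\<^sup>2 = (\<epsilon>/2)\<^sup>2\<close> no longer depend on \<open>\<tau>\<close>,
  while every other term is at most \<open>exp(-\<pi>(Im \<tau> - 1))\<close> times its majorant at \<open>Im \<tau> = 1\<close>, up to a constant.  Convergence that is uniform in \<open>\<zeta>\<close> is what allows passing to derivatives in \<open>\<zeta>\<close>.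
\<close>
lemma theta_char_degeneration:
  fixes T :: "'a \<Rightarrow> complex"
  assumes lim: "filterlim (\<lambda>k. Im (T k)) at_top F"
    and K: "finite K" "\<And>n. n \<in> K \<Longrightarrow> (of_int n + \<epsilon> / 2)\<^sup>2 = (\<epsilon> / 2)\<^sup>2"
    and gap: "\<And>n. n \<notin> K \<Longrightarrow> (of_int n + \<epsilon> / 2)\<^sup>2 \<ge> (\<epsilon> / 2)\<^sup>2 + 1"
  shows "uniform_limit (ball 0 1)
           (\<lambda>k \<zeta>. exp (- (of_real pi * \<i> * of_real ((\<epsilon> / 2)\<^sup>2) * T k)) * theta_char \<epsilon> \<epsilon>' \<zeta> (T k))
           (\<lambda>\<zeta>. \<Sum>n\<in>K. exp (2 * of_real pi * \<i> * (of_int n + of_real \<epsilon> / 2) * (\<zeta> + of_real \<epsilon>' / 2))) F"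
proof -
  define c where "c \<tau> = exp (- (of_real pi * \<i> * of_real ((\<epsilon> / 2)\<^sup>2) * \<tau>))" for \<tau> :: complex
  define L where "L \<zeta> = (\<Sum>n\<in>K. exp (2 * of_real pi * \<i> * (of_int n + of_real \<epsilon> / 2) * (\<zeta> + of_real \<epsilon>' / 2)))"
    for \<zeta> :: complex
  define C where "C = exp (pi * (\<epsilon> / 2)\<^sup>2) * infsum (theta_majorant \<epsilon> 1 1) (- K)"
  note maj = summable_on_subset_banach[OF summable_theta_majorant[of 1 \<epsilon> 1], of "- K", simplified]
  have bound: "dist (c \<tau> * theta_char \<epsilon> \<epsilon>' \<zeta> \<tau>) (L \<zeta>) \<le> exp (- pi * (Im \<tau> - 1)) * C"
    if \<tau>: "Im \<tau> \<ge> 1" and \<zeta>: "\<zeta> \<in> ball 0 1" for \<tau> \<zeta>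
  proof -
    define u where "u = (\<lambda>n. c \<tau> * theta_term \<epsilon> \<epsilon>' \<zeta> \<tau> n)"
    have "theta_term \<epsilon> \<epsilon>' \<zeta> \<tau> summable_on UNIV"
      by (rule abs_summable_summable[OF theta_term_abs_summable]) (use \<tau> in simp)
    hence u: "u summable_on A" for A
      unfolding u_def by (intro summable_on_cmult_right) (rule summable_on_subset_banach, auto)
    have "c \<tau> * theta_char \<epsilon> \<epsilon>' \<zeta> \<tau> = infsum u UNIV"
      by (simp add: u_def theta_char_eq_infsum infsum_cmult_right')
    also have "\<dots> = infsum u K + infsum u (- K)"
      using infsum_Un_disjoint[OF u[of K] u[of "- K"]] by simp
    also have "infsum u K = L \<zeta>"
    proof -
      have "u n = exp (2 * of_real pi * \<i> * (of_int n + of_real \<epsilon> / 2) * (\<zeta> + of_real \<epsilon>' / 2))"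
        if "n \<in> K" for n
      proof -
        have "(of_int n + of_real \<epsilon> / 2)\<^sup>2 = (of_real ((\<epsilon> / 2)\<^sup>2) :: complex)"
          by (subst K(2)[OF that, symmetric]) simp
        thus ?thesis
          by (simp add: u_def c_def theta_term_def exp_add [symmetric] algebra_simps)
      qed
      thus ?thesis using K(1) by (simp add: L_def)
    qed
    finally have eq: "c \<tau> * theta_char \<epsilon> \<epsilon>' \<zeta> \<tau> - L \<zeta> = infsum u (- K)" by simp
    have le: "norm (u n) \<le> exp (- pi * (Im \<tau> - 1)) * exp (pi * (\<epsilon> / 2)\<^sup>2) * theta_majorant \<epsilon> 1 1 n"
      if "n \<in> - K" for n
    proof -
      define m where "m = of_int n + \<epsilon> / 2"
      have "norm (u n) = exp (- pi * (m\<^sup>2 - (\<epsilon> / 2)\<^sup>2) * (Im \<tau> - 1)) * exp (pi * (\<epsilon> / 2)\<^sup>2)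
              * exp (- pi * m\<^sup>2 * 1 - 2 * pi * m * Im \<zeta>)"
        by (simp add: u_def c_def norm_mult norm_theta_term m_def [symmetric] exp_add [symmetric] algebra_simps
              del: of_real_power of_real_divide)
      also have "exp (- pi * (m\<^sup>2 - (\<epsilon> / 2)\<^sup>2) * (Im \<tau> - 1)) \<le> exp (- pi * (Im \<tau> - 1))"
      proof -
        have "1 * (Im \<tau> - 1) \<le> (m\<^sup>2 - (\<epsilon> / 2)\<^sup>2) * (Im \<tau> - 1)"
          using gap[of n] that \<tau> by (intro mult_right_mono) (auto simp: m_def)
        hence "pi * (Im \<tau> - 1) \<le> pi * ((m\<^sup>2 - (\<epsilon> / 2)\<^sup>2) * (Im \<tau> - 1))"
          by (intro mult_left_mono) auto
        thus ?thesis by (simp add: mult.assoc)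
      qed
      also have "exp (- pi * m\<^sup>2 * 1 - 2 * pi * m * Im \<zeta>) \<le> theta_majorant \<epsilon> 1 1 n"
        \<comment> \<open>The left-hand side is the norm of a theta term at \<open>\<tau> = \<i>\<close>.\<close>
        using norm_theta_term_le_majorant[of 1 \<i> \<zeta> 1 \<epsilon> 0 n] \<zeta> abs_Im_le_cmod[of \<zeta>]
        by (simp add: norm_theta_term m_def)
      finally show ?thesis by (simp add: mult_mono)
    qed
    have "norm (infsum u (- K)) \<le> exp (- pi * (Im \<tau> - 1)) * C"
      unfolding C_def mult.assoc [symmetric]
      by (rule norm_infsum_le[OF has_sum_infsum[OF u]
            has_sum_cmult_right[OF has_sum_infsum[OF maj]] le])
    thus ?thesis by (simp add: dist_norm eq)
  qed
  have "((\<lambda>t. exp (- pi * (t - 1)) * C) \<longlongrightarrow> 0) at_top"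
    by real_asymp
  from filterlim_compose[OF this lim]
  have small: "((\<lambda>k. exp (- pi * (Im (T k) - 1)) * C) \<longlongrightarrow> 0) F" .
  show ?thesis
    unfolding c_def [symmetric] L_def [symmetric]
  proof (rule uniform_limitI)
    fix e :: real assume "e > 0"
    with small have "\<forall>\<^sub>F k in F. exp (- pi * (Im (T k) - 1)) * C < e"
      by (rule order_tendstoD(2))
    moreover have "\<forall>\<^sub>F k in F. Im (T k) \<ge> 1"
      using lim by (simp add: filterlim_at_top)
    ultimately show "\<forall>\<^sub>F k in F. \<forall>\<zeta>\<in>ball 0 1. dist (c (T k) * theta_char \<epsilon> \<epsilon>' \<zeta> (T k)) (L \<zeta>) < e"
      by eventually_elim (use bound in \<open>force intro: le_less_trans\<close>)
  qed
qed

context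
  fixes T :: "'a \<Rightarrow> complex" and F :: "'a filter"
  assumes lim: "filterlim (\<lambda>k. Im (T k)) at_top F"
begin

lemma theta_char_0_degeneration: "((\<lambda>k. theta_char 0 \<epsilon>' 0 (T k)) \<longlongrightarrow> 1) F"
proof -
  have gap: "(of_int n + 0 / 2)\<^sup>2 \<ge> (0 / 2)\<^sup>2 + (1 :: real)" if "n \<notin> {0}" for n :: int
  proof -
    have "n\<^sup>2 > 0" using that by simp
    hence "1 \<le> real_of_int (n\<^sup>2)" by linarith
    thus ?thesis by simp
  qed
  have "uniform_limit (ball 0 1) (\<lambda>k \<zeta>. theta_char 0 \<epsilon>' \<zeta> (T k)) (\<lambda>\<zeta>. 1) F"
    using theta_char_degeneration[OF lim, of "{0}" 0 \<epsilon>', OF _ _ gap] by simp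
  from tendsto_uniform_limitI[OF this, of 0] show ?thesis by simp
qed

lemma theta_char_1_degeneration:
  "uniform_limit (ball 0 1) (\<lambda>k \<zeta>. exp (- (of_real pi * \<i> * T k / 4)) * theta_char 1 \<epsilon>' \<zeta> (T k))
     (\<lambda>\<zeta>. exp (of_real pi * \<i> * (\<zeta> + of_real \<epsilon>' / 2)) + exp (- (of_real pi * \<i> * (\<zeta> + of_real \<epsilon>' / 2)))) F"
proof -
  have gap: "(of_int n + 1 / 2)\<^sup>2 \<ge> (1 / 2)\<^sup>2 + (1 :: real)" if "n \<notin> {0, -1}" for n :: int
  proof -
    \<comment> \<open>The gap is \<open>(n + 1/2)\<^sup>2 - 1/4 = n(n + 1)\<close>.\<close>
    have "1 \<le> n * (n + 1)"
    proof (cases "n > 0")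
      case True
      thus ?thesis using mult_mono[of 1 n 1 "n + 1"] by simp
    next
      case False
      thus ?thesis using that mult_mono[of 1 "- n" 1 "- n - 1"] by (simp add: algebra_simps)
    qed
    hence "1 \<le> real_of_int (n * (n + 1))" by linarith
    thus ?thesis by (simp add: power2_eq_square algebra_simps)
  qed
  have K: "(of_int n + 1 / 2)\<^sup>2 = (1 / 2 :: real)\<^sup>2" if "n \<in> {0, -1}" for n :: int
    using that by (auto simp: power2_eq_square)
  show ?thesis
    using theta_char_degeneration[OF lim, of "{0, -1}" 1 \<epsilon>', OF _ K gap]
    by (simp add: power2_eq_square algebra_simps)
qed

lemma theta_char_10_degeneration:
  "((\<lambda>k. exp (- (of_real pi * \<i> * T k / 4)) * theta_char 1 0 0 (T k)) \<longlongrightarrow> 2) F"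
  using tendsto_uniform_limitI[OF theta_char_1_degeneration[of 0], of 0] by simp

lemma theta_char_deriv0_11_degeneration:
  "((\<lambda>k. exp (- (of_real pi * \<i> * T k / 4)) * theta_char_deriv0 1 1 (T k)) \<longlongrightarrow> - 2 * of_real pi) F"
proof (cases "F = bot")
  case False
  define f where "f = (\<lambda>k \<zeta>. exp (- (of_real pi * \<i> * T k / 4)) * theta_char 1 1 \<zeta> (T k))"
  define g :: "complex \<Rightarrow> complex" where
    "g = (\<lambda>\<zeta>. exp (of_real pi * \<i> * (\<zeta> + of_real 1 / 2)) + exp (- (of_real pi * \<i> * (\<zeta> + of_real 1 / 2))))"
  have pos: "\<forall>\<^sub>F k in F. Im (T k) > 0"
    using lim by (simp add: filterlim_at_top_dense)
  have "((\<lambda>k. deriv (f k) 0) \<longlongrightarrow> deriv g 0) F"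
  proof (rule deriv_complex_uniform_limit)
    show "uniform_limit (ball 0 1) f g F"
      unfolding f_def g_def by (rule theta_char_1_degeneration)
    show "\<forall>\<^sub>F k in F. f k holomorphic_on ball 0 1"
      using pos by eventually_elim (auto simp: f_def intro!: holomorphic_intros theta_char_holomorphic)
  qed (use False in auto)
  moreover have "\<forall>\<^sub>F k in F. deriv (f k) 0 = exp (- (of_real pi * \<i> * T k / 4)) * theta_char_deriv0 1 1 (T k)"
    using pos
  proof eventually_elim
    case (elim k)
    show ?case unfolding f_def
      by (rule DERIV_imp_deriv) (rule DERIV_cmult theta_char_has_deriv0 elim)+
  qed
  moreover have "deriv g 0 = - 2 * of_real pi"
  proof (rule DERIV_imp_deriv)
    have e: "exp (of_real pi * \<i> / 2) = \<i>" "exp (- (of_real pi * \<i> / 2)) = - \<i>"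
      using exp_Euler[of "of_real pi / 2"] exp_Euler[of "- of_real pi / 2"]
      by (simp_all add: mult.commute cos_of_real sin_of_real flip: of_real_divide)
    hence e': "exp (\<i> * of_real pi / 2) = \<i>" "exp (- (\<i> * of_real pi / 2)) = - \<i>"
      by (simp_all add: mult.commute)
    show "(g has_field_derivative - 2 * of_real pi) (at 0)"
      unfolding g_def by (rule derivative_eq_intros refl)+ (simp add: e' algebra_simps)
  qed
  ultimately show ?thesis
    by (simp add: tendsto_cong)
qed auto

end

section \<open>Duplication formulas\<close>

text \<open>\<open>\<theta>[1,1]\<close> is an odd function: reflection gives the characteristic \<open>[-1,-1]\<close>, and moving it back to \<open>[1,1]\<close>
  costs a factor \<open>exp(\<pi>i) = -1\<close>.\<close>
lemma theta_char_11_zero: "theta_char 1 1 0 \<tau> = 0"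
proof -
  have "theta_char 1 1 0 \<tau> = theta_char (-1 + 2) (-1) 0 \<tau>"
    using theta_char_reflect[of 1 1 0 \<tau>] by (simp only: theta_char_shift_upper) simp
  moreover have "theta_char 1 1 0 \<tau> = - theta_char 1 (-1) 0 \<tau>"
    using theta_char_shift_lower[of 1 "-1" 0 \<tau>] exp_pi_i by simp
  ultimately show ?thesis by simp
qed

text \<open>\<open>\<theta>[0,1]\<close> is an even function.\<close>
lemma theta_char_deriv0_01_zero:
  assumes "Im \<tau> > 0"
  shows "theta_char_deriv0 0 1 \<tau> = 0"
proof -
  have even: "theta_char 0 1 (- \<zeta>) \<tau> = theta_char 0 1 \<zeta> \<tau>" for \<zeta>
    using theta_char_reflect[of 0 "-1" \<zeta> \<tau>] theta_char_shift_lower[of 0 "-1" \<zeta> \<tau>] by simp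
  note d = theta_char_has_deriv0[OF assms, of 0 1]
  have "((\<lambda>\<zeta>. theta_char 0 1 (- \<zeta>) \<tau>) has_field_derivative theta_char_deriv0 0 1 \<tau> * (- 1)) (at 0)"
    by (rule DERIV_chain2[where g = uminus]) (use d in \<open>auto intro!: derivative_eq_intros\<close>)
  from DERIV_unique[OF this[unfolded even] d] show ?thesis by simp
qed

lemma theta_char_0_neg1: "theta_char 0 (-1) \<zeta> \<tau> = theta_char 0 1 \<zeta> \<tau>"
  using theta_char_shift_lower[of 0 "-1" \<zeta> \<tau>] by simp

lemma theta_00_01_duplication:
  assumes "Im \<tau> > 0"
  shows "theta_char 0 0 0 \<tau> * theta_char 0 1 0 \<tau> = theta_char 0 1 0 (2 * \<tau>) ^ 2"
  using theta_char_product[OF assms, of 0 0 0 0 1 0]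
  by (simp add: theta_char_11_zero theta_char_0_neg1 power2_eq_square)

lemma theta_10_duplication:
  assumes "Im \<tau> > 0"
  shows "theta_char 1 0 0 \<tau> ^ 2 = 2 * theta_char 1 0 0 (2 * \<tau>) * theta_char 0 0 0 (2 * \<tau>)"
  using theta_char_product[OF assms, of 1 0 0 1 0 0] theta_char_shift_upper[of 0 0 0 "2 * \<tau>"]
  by (simp add: power2_eq_square)

lemma theta_11_10_duplication:
  assumes "Im \<tau> > 0"
  shows "theta_char 1 1 \<zeta> \<tau> * theta_char 1 0 \<zeta> \<tau> = theta_char 1 1 (2 * \<zeta>) (2 * \<tau>) * theta_char 0 1 0 (2 * \<tau>)"
  using theta_char_product[OF assms, of 1 1 \<zeta> 1 0 \<zeta>]
  by (simp add: theta_char_11_zero flip: mult_2)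

lemma theta_1_half_duplication:
  assumes "Im \<tau> > 0"
  shows "theta_char 1 (1/2) \<zeta> \<tau> ^ 2
       = theta_char 1 1 (2 * \<zeta>) (2 * \<tau>) * theta_char 0 0 0 (2 * \<tau>)
       + theta_char 0 1 (2 * \<zeta>) (2 * \<tau>) * theta_char 1 0 0 (2 * \<tau>)"
  using theta_char_product[OF assms, of 1 "1/2" \<zeta> 1 "1/2" \<zeta>] theta_char_shift_upper[of 0 1 "2 * \<zeta>" "2 * \<tau>"]
  by (simp add: power2_eq_square flip: mult_2)

lemma theta_0_half_duplication:
  assumes "Im \<tau> > 0"
  shows "theta_char 0 (1/2) \<zeta> \<tau> ^ 2
       = theta_char 0 1 (2 * \<zeta>) (2 * \<tau>) * theta_char 0 0 0 (2 * \<tau>)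
       + theta_char 1 1 (2 * \<zeta>) (2 * \<tau>) * theta_char 1 0 0 (2 * \<tau>)"
  using theta_char_product[OF assms, of 0 "1/2" \<zeta> 0 "1/2" \<zeta>]
  by (simp add: power2_eq_square flip: mult_2)

section \<open>Non-vanishing of the theta constants\<close>

lemma Im_doubling: "Im (2 ^ k * \<tau>) = 2 ^ k * Im \<tau>"
  by (induction k) (simp_all add: mult.assoc)

lemma filterlim_Im_doubling:
  assumes "Im \<tau> > 0"
  shows "filterlim (\<lambda>k. Im (2 ^ k * \<tau>)) at_top sequentially"
proof -
  have "(\<lambda>k. Im (2 ^ k * \<tau>)) = (\<lambda>k. 2 ^ k * Im \<tau>)"
    by (simp add: Im_doubling)
  moreover have "filterlim (\<lambda>k. 2 ^ k * Im \<tau>) at_top sequentially"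
    using assms by real_asymp
  ultimately show ?thesis by simp
qed

lemma doubling_invariant:
  assumes "Im \<tau> > 0" "P \<tau>" "\<And>\<sigma>. Im \<sigma> > 0 \<Longrightarrow> P \<sigma> \<Longrightarrow> P (2 * \<sigma>)"
  shows "P (2 ^ k * \<tau>)"
proof (induction k)
  case (Suc k)
  with assms(1) assms(3)[of "2 ^ k * \<tau>"] show ?case by (simp add: Im_doubling mult.assoc)
qed (use assms in simp)

text \<open>
  By \<open>theta_00_01_duplication\<close> a zero at \<open>\<tau>\<close> forces one at \<open>2\<tau>\<close>, hence at every \<open>2\<^sup>k\<tau>\<close>, whereas the values
  there tend to \<open>1\<close>.
\<close>
lemma theta_01_nonzero:
  assumes "Im \<tau> > 0"
  shows "theta_char 0 1 0 \<tau> \<noteq> 0"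
proof
  assume "theta_char 0 1 0 \<tau> = 0"
  hence "theta_char 0 1 0 (2 ^ k * \<tau>) = 0" for k
  proof (rule doubling_invariant[OF assms])
    fix \<sigma> assume "Im \<sigma> > 0" "theta_char 0 1 0 \<sigma> = 0"
    thus "theta_char 0 1 0 (2 * \<sigma>) = 0" using theta_00_01_duplication[of \<sigma>] by simp
  qed
  with theta_char_0_degeneration[OF filterlim_Im_doubling[OF assms], of 1] show False
    by (simp add: LIMSEQ_const_iff)
qed

lemma theta_00_nonzero:
  assumes "Im \<tau> > 0"
  shows "theta_char 0 0 0 \<tau> \<noteq> 0"
  using theta_00_01_duplication[OF assms] theta_01_nonzero[of "2 * \<tau>"] assms by auto

text \<open>
  Doubling as before, now through \<open>theta_10_duplication\<close>; the values must be renormalised by \<open>exp(-\<pi>i\<tau>/4)\<close> to have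
  a nonzero limit.
\<close>
lemma theta_10_nonzero:
  assumes "Im \<tau> > 0"
  shows "theta_char 1 0 0 \<tau> \<noteq> 0"
proof
  assume "theta_char 1 0 0 \<tau> = 0"
  hence "theta_char 1 0 0 (2 ^ k * \<tau>) = 0" for k
  proof (rule doubling_invariant[OF assms])
    fix \<sigma> assume "Im \<sigma> > 0" "theta_char 1 0 0 \<sigma> = 0"
    thus "theta_char 1 0 0 (2 * \<sigma>) = 0"
      using theta_10_duplication[of \<sigma>] theta_00_nonzero[of "2 * \<sigma>"] by simp
  qed
  with theta_char_10_degeneration[OF filterlim_Im_doubling[OF assms]] show False
    by (simp add: LIMSEQ_const_iff)
qed

section \<open>Jacobi's derivative formula\<close>

lemma theta_char_has_deriv0_double:
  assumes "Im \<tau> > 0"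
  shows "((\<lambda>\<zeta>. theta_char \<epsilon> \<epsilon>' (2 * \<zeta>) \<tau>) has_field_derivative 2 * theta_char_deriv0 \<epsilon> \<epsilon>' \<tau>) (at 0)"
proof -
  have "((\<lambda>\<zeta>. theta_char \<epsilon> \<epsilon>' (2 * \<zeta>) \<tau>) has_field_derivative theta_char_deriv0 \<epsilon> \<epsilon>' \<tau> * 2) (at 0)"
    by (rule DERIV_chain2[where g = "\<lambda>\<zeta>. 2 * \<zeta>"])
       (use theta_char_has_deriv0[OF assms, of \<epsilon> \<epsilon>'] in \<open>auto intro!: derivative_eq_intros\<close>)
  thus ?thesis by (simp add: mult.commute)
qed

text \<open>The derivative of \<open>theta_11_10_duplication\<close> at \<open>\<zeta> = 0\<close>, where \<open>\<theta>[1,1]\<close> vanishes.\<close>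
lemma theta_char_deriv0_11_duplication:
  assumes "Im \<tau> > 0"
  shows "theta_char_deriv0 1 1 \<tau> * theta_char 1 0 0 \<tau> = 2 * theta_char_deriv0 1 1 (2 * \<tau>) * theta_char 0 1 0 (2 * \<tau>)"
proof -
  have "((\<lambda>\<zeta>. theta_char 1 1 \<zeta> \<tau> * theta_char 1 0 \<zeta> \<tau>) has_field_derivative
           theta_char_deriv0 1 1 \<tau> * theta_char 1 0 0 \<tau>) (at 0)"
    using DERIV_mult[OF theta_char_has_deriv0[OF assms, of 1 1] theta_char_has_deriv0[OF assms, of 1 0]]
    by (simp add: theta_char_11_zero)
  moreover have "((\<lambda>\<zeta>. theta_char 1 1 \<zeta> \<tau> * theta_char 1 0 \<zeta> \<tau>) has_field_derivative
           2 * theta_char_deriv0 1 1 (2 * \<tau>) * theta_char 0 1 0 (2 * \<tau>)) (at 0)"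
    unfolding theta_11_10_duplication[OF assms]
    by (rule DERIV_cmult_right theta_char_has_deriv0_double)+ (use assms in simp)
  ultimately show ?thesis by (rule DERIV_unique)
qed

text \<open>
  The quotient \<open>J\<close> is unchanged under \<open>\<tau> \<mapsto> 2\<tau>\<close> by the three duplication formulas, so it equals its limit along
  \<open>2\<^sup>k\<tau>\<close>.  The factors \<open>exp(-\<pi>i\<tau>/4)\<close> that normalise \<open>\<theta>'[1,1]\<close> and \<open>\<theta>[1,0]\<close> cancel, and the limit is
  \<open>-2\<pi> / (2 \<sqdot> 1 \<sqdot> 1)\<close>.
\<close>
theorem jacobi_derivative_formula:
  assumes "Im \<tau> > 0"
  shows "theta_char_deriv0 1 1 \<tau> = - of_real pi * theta_char 0 0 0 \<tau> * theta_char 0 1 0 \<tau> * theta_char 1 0 0 \<tau>"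
proof -
  define J where "J \<sigma> = theta_char_deriv0 1 1 \<sigma> / (theta_char 1 0 0 \<sigma> * (theta_char 0 0 0 \<sigma> * theta_char 0 1 0 \<sigma>))" for \<sigma>
  have inv: "J (2 * \<sigma>) = J \<sigma>" if "Im \<sigma> > 0" for \<sigma>
  proof -
    have [simp]: "theta_char 1 0 0 \<sigma> \<noteq> 0" "theta_char 0 1 0 (2 * \<sigma>) \<noteq> 0"
      using that by (auto simp: theta_10_nonzero theta_01_nonzero)
    have "J \<sigma> = (theta_char_deriv0 1 1 \<sigma> * theta_char 1 0 0 \<sigma>)
                  / (theta_char 1 0 0 \<sigma> ^ 2 * (theta_char 0 0 0 \<sigma> * theta_char 0 1 0 \<sigma>))"
      by (simp add: J_def power2_eq_square)
    also have "\<dots> = J (2 * \<sigma>)"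
      unfolding theta_char_deriv0_11_duplication[OF that] theta_10_duplication[OF that]
        theta_00_01_duplication[OF that]
      by (simp add: J_def power2_eq_square)
    finally show ?thesis ..
  qed
  have const: "J (2 ^ k * \<tau>) = J \<tau>" for k
    by (rule doubling_invariant[OF assms]) (simp_all add: inv)
  note lim = filterlim_Im_doubling[OF assms]
  have "(\<lambda>k. J (2 ^ k * \<tau>)) \<longlonglongrightarrow> (- 2 * of_real pi) / (2 * (1 * 1))"
  proof -
    define c where "c k = exp (- (of_real pi * \<i> * (2 ^ k * \<tau>) / 4))" for k
    have "(\<lambda>k. (c k * theta_char_deriv0 1 1 (2 ^ k * \<tau>)) / ((c k * theta_char 1 0 0 (2 ^ k * \<tau>)) *
             (theta_char 0 0 0 (2 ^ k * \<tau>) * theta_char 0 1 0 (2 ^ k * \<tau>)))) \<longlonglongrightarrow> (- 2 * of_real pi) / (2 * (1 * 1))"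
      unfolding c_def
      by (intro tendsto_divide tendsto_mult theta_char_deriv0_11_degeneration
            theta_char_10_degeneration theta_char_0_degeneration lim) auto
    moreover have "c k \<noteq> 0" for k by (simp add: c_def)
    ultimately show ?thesis by (simp add: J_def mult.assoc)
  qed
  hence "J \<tau> = - of_real pi"
    by (simp add: const LIMSEQ_const_iff)
  thus ?thesis
    using theta_00_nonzero[OF assms] theta_01_nonzero[OF assms] theta_10_nonzero[OF assms]
    by (simp add: J_def field_simps)
qed

section \<open>Derivatives at the characteristics with lower entry one half\<close>

theorem theorem3p1:
  fixes \<tau> :: complex
  assumes "Im \<tau> > 0"
  shows
    "theta_char_deriv0 1 (1/2) \<tau>
       = 1 / 4 * (theta_char_deriv0 1 1 \<tau> * theta_char 1 0 0 \<tau> ^ 3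
                  / theta_char 1 (1/2) 0 \<tau> ^ 3)
     \<and> 1 / 4 * (theta_char_deriv0 1 1 \<tau> * theta_char 1 0 0 \<tau> ^ 3
                  / theta_char 1 (1/2) 0 \<tau> ^ 3)
       = - of_real pi * theta_char 0 0 0 (2 * \<tau>) ^ 2 * theta_char 1 (1/2) 0 \<tau>
     \<and> theta_char_deriv0 0 (1/2) \<tau>
       = 1 / 4 * (theta_char_deriv0 1 1 \<tau> * theta_char 1 0 0 \<tau> ^ 3
                  / theta_char 0 (1/2) 0 \<tau> ^ 3)
     \<and> 1 / 4 * (theta_char_deriv0 1 1 \<tau> * theta_char 1 0 0 \<tau> ^ 3
                  / theta_char 0 (1/2) 0 \<tau> ^ 3)
       = - of_real pi * theta_char 1 0 0 (2 * \<tau>) ^ 2 * theta_char 0 (1/2) 0 \<tau>"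
proof -
  have pos: "Im (2 * \<tau>) > 0" using assms by simp
  define A where "A = theta_char 1 0 0 (2 * \<tau>)"
  define B where "B = theta_char 0 0 0 (2 * \<tau>)"
  define C where "C = theta_char 0 1 0 (2 * \<tau>)"
  define p where "p = theta_char 1 (1/2) 0 \<tau>"
  define r where "r = theta_char 0 (1/2) 0 \<tau>"
  define p' where "p' = theta_char_deriv0 1 (1/2) \<tau>"
  define r' where "r' = theta_char_deriv0 0 (1/2) \<tau>"
  define D where "D = theta_char_deriv0 1 1 \<tau>"
  define E where "E = theta_char 1 0 0 \<tau>"
  note defs = A_def B_def C_def p_def r_def p'_def r'_def D_def E_def
  have nz: "A \<noteq> 0" "B \<noteq> 0" "C \<noteq> 0"
    unfolding defs using pos by (simp_all add: theta_00_nonzero theta_01_nonzero theta_10_nonzero)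
  have p2: "p\<^sup>2 = A * C" and r2: "r\<^sup>2 = B * C"
    using theta_1_half_duplication[OF assms, of 0] theta_0_half_duplication[OF assms, of 0]
    by (simp_all add: defs theta_char_11_zero mult.commute)
  hence pr: "p \<noteq> 0" "r \<noteq> 0" using nz by auto
  have D2: "theta_char_deriv0 1 1 (2 * \<tau>) = - of_real pi * A * B * C"
    using jacobi_derivative_formula[OF pos] by (simp add: defs)
  have sq: "((\<lambda>\<zeta>. theta_char \<epsilon> \<epsilon>' \<zeta> \<tau> ^ 2) has_field_derivative
              2 * theta_char \<epsilon> \<epsilon>' 0 \<tau> * theta_char_deriv0 \<epsilon> \<epsilon>' \<tau>) (at 0)" for \<epsilon> \<epsilon>'
    using DERIV_power[OF theta_char_has_deriv0[OF assms], of \<epsilon> \<epsilon>' 2] by (simp add: mult_ac)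
  note double = theta_char_has_deriv0_double[OF pos]
  note dup = DERIV_add[OF DERIV_cmult_right[OF double] DERIV_cmult_right[OF double]]
  \<comment> \<open>Both sides are the derivative at \<open>0\<close> of \<open>theta_1_half_duplication\<close>; the factor \<open>2\<close> on the right comes from
    the argument \<open>2\<zeta>\<close>.\<close>
  have "2 * p * p' = 2 * theta_char_deriv0 1 1 (2 * \<tau>) * B + 2 * theta_char_deriv0 0 1 (2 * \<tau>) * A"
    unfolding defs
    by (rule DERIV_unique[OF sq]) (unfold theta_1_half_duplication[OF assms], rule dup)
  hence "p * p' = p * (- of_real pi * B\<^sup>2 * p)"
    using p2 by (simp add: theta_char_deriv0_01_zero[OF pos] D2 power2_eq_square) algebra
  hence p': "p' = - of_real pi * B\<^sup>2 * p" using pr by (simp only: mult_cancel_left simp_thms)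
  have "2 * r * r' = 2 * theta_char_deriv0 0 1 (2 * \<tau>) * B + 2 * theta_char_deriv0 1 1 (2 * \<tau>) * A"
    unfolding defs
    by (rule DERIV_unique[OF sq]) (unfold theta_0_half_duplication[OF assms], rule dup)
  hence "r * r' = r * (- of_real pi * A\<^sup>2 * r)"
    using r2 by (simp add: theta_char_deriv0_01_zero[OF pos] D2 power2_eq_square) algebra
  hence r': "r' = - of_real pi * A\<^sup>2 * r" using pr by (simp only: mult_cancel_left simp_thms)
  have DE: "D * E = 2 * (- of_real pi * A * B * C) * C"
    using theta_char_deriv0_11_duplication[OF assms] by (simp add: defs D2[unfolded defs])
  have E2: "E\<^sup>2 = 2 * A * B"
    using theta_10_duplication[OF assms] by (simp add: defs)
  have "D * E ^ 3 = (D * E) * E\<^sup>2" by (simp add: power3_eq_cube power2_eq_square)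
  hence DE3: "D * E ^ 3 = - 4 * of_real pi * (A * B * C)\<^sup>2"
    by (simp only: DE E2) (simp add: power2_eq_square)
  have "p * p ^ 3 = (p\<^sup>2)\<^sup>2" and "r * r ^ 3 = (r\<^sup>2)\<^sup>2"
    by (simp_all add: power3_eq_cube power2_eq_square)
  hence "p * p ^ 3 = (A * C)\<^sup>2" and "r * r ^ 3 = (B * C)\<^sup>2"
    by (simp_all only: p2 r2)
  hence "D * E ^ 3 = 4 * (- of_real pi * B\<^sup>2 * p) * p ^ 3"
    and "D * E ^ 3 = 4 * (- of_real pi * A\<^sup>2 * r) * r ^ 3"
    by (simp_all add: DE3 power_mult_distrib mult.assoc mult.left_commute)
  hence "1 / 4 * (D * E ^ 3 / p ^ 3) = - of_real pi * B\<^sup>2 * p"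
    and "1 / 4 * (D * E ^ 3 / r ^ 3) = - of_real pi * A\<^sup>2 * r"
    using pr by simp_all
  thus ?thesis
    unfolding defs [symmetric] by (simp only: p' r')
qed

end
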